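(* Let $n>0$ and $\alpha\ge 0$ be integers, and let $f(u)$ be any polynomial function of $u\in\mathbb{Z}$ such that $f(u)$ is a positive integer for every $u\in\mathbb{Z}$. Write $f$ for $f(u)$. Suppose that $$D=f^{2}\pm 2^{\alpha}n,$$ where $D$ is a positive integer that is not a perfect square, and that, for all $u\in\mathbb{Z}$, $$f\equiv 2^{\alpha-2}n \pmod{2^{\alpha-1}n}.$$ Let $r+1$ be the period length of the regular continued fraction $\sqrt D=[a_0;\overline{a_1,\dots,a_r,2a_0}]$, that is, $r+1$ is the first index $i\ge 1$ for which $a_i=2a_0$, with $r>0$. Then the convergent $p_r/q_r$ of $\sqrt D$ is as follows (with signs corresponding to the sign in $D$). If $f\equiv 0\pmod 2$, $$\frac{p_r}{q_r}=\frac{\;\dfrac{f^{2}\left(f^{2}\pm 2^{\alpha}n\right)}{2^{2\alpha-3}n^{2}}+1\;}{\dfrac{f\left(f^{2}\pm 2^{\alpha-1}n\right)}{2^{2\alpha-3}n^{2}}},$$ and, if $f\equiv 1\pmod 2$, $$\frac{p_r}{q_r}=\frac{\;\dfrac{f^{2}\left(f^{2}\pm 3\times 2^{\alpha-2}n\right)^{2}}{2^{3\alpha-5}n^{3}}\pm 1\;}{\dfrac{f\left(f^{2}\pm 2^{\alpha-2}n\right)\left(f^{2}\pm 3\times 2^{\alpha-2}n\right)}{2^{3\alpha-5}n^{3}}},$$ under the following conditions. For $D=f^2+2^{\alpha}n$ and $f\equiv 0$ or $1 \pmod 2$: - if $1\le n\le 2^{2-\alpha}$, then $f\ge 2^{\alpha-1}n$;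 - if $n>2^{2-\alpha}$, then $f\ge 3\times 2^{\alpha-2}n-1$. For $D=f^2-2^{\alpha}n$ and $f\equiv 0\pmod 2$: - if $\alpha\ge 2$, or if $\alpha=0$ or $1$ and $3n\ge 2^{3-\alpha}$, then $f\ge 2^{\alpha}n$; - if $\alpha=0$ or $1$ and $3n<2^{3-\alpha}$, then $f\ge 2^{\alpha-2}n+2$. For $D=f^2-2^{\alpha}n$ and $f\equiv 1\pmod 2$: - if $n\ge 2^{2-\alpha}+1$, then $f\ge 3\times 2^{\alpha-2}n$; - if $1\le n\le 2^{2-\alpha}$, then $f>2^{\alpha-3}n+3$.
   Context: The congruence $f\equiv 2^{\alpha-2}n \pmod{2^{\alpha-1}n}$, together with $f>0$, means that $f=2^{\alpha-2}(2k+1)n$ for some integer $k\ge 0$ (the numbers $2^{\alpha-2}n$ and $2^{\alpha-1}n$ need not be integers when $\alpha<2$). For a positive non-square integer $D$, the regular continued fraction of $\sqrt D$ has the form $\sqrt D=[a_0;\overline{a_1,\dots,a_r,2a_0}]$ with $a_0=\lfloor\sqrt D\rfloor$, where the bar indicates the period, of length $r+1$; the partial denominators are computed successively until the term $a_{r+1}=2a_0$ is found. The convergents $p_i/q_i$ are given by $p_i=a_ip_{i-1}+p_{i-2}$, $q_i=a_iq_{i-1}+q_{i-2}$, with $p_{-1}=1$, $p_0=a_0$, $q_{-1}=0$, $q_0=1$. The fundamental (smallest nontrivial positive) solution of the Pell equation $X^2-DY^2=1$ is $(p_r,q_r)$ if $r$ is odd and $(p_{2r+1},q_{2r+1})$ if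 $r$ is even.
   Formalization: For f odd and n = 2^(2-α) (that is, D = f² ± 4) the printed claim about p_r/q_r is false (α=2, n=1, f=3, D=13: p_4/q_4 = 18/5, but the formula gives 649/180); in that case the formula is proved for the convergent p_{2r+1}/q_{2r+1} instead. *)

theory Defs
  imports Complex_Main "HOL-Library.Real_Mod"
    "HOL-Computational_Algebra.Polynomial" "HOL-Computational_Algebra.Nth_Powers"
begin

text \<open>Real coefficients cover all polynomial functions that take integer values at the integers
  (such as \<open>u * (u + 1) / 2\<close>): the coefficients are then necessarily rational.\<close>

definition int_valued_polynomial :: "(int \<Rightarrow> int) \<Rightarrow> bool" where
  "int_valued_polynomial f \<longleftrightarrow> (\<exists>p :: real poly. \<forall>u. poly p (of_int u) = of_int (f u))"

text \<open>Complete quotients and partial denominators of the regular continued fraction of \<open>x\<close>.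
  They are meaningful at every index only for irrational \<open>x\<close>; for rational \<open>x\<close> the quotients
  become 0 after the expansion terminates.\<close>

fun cf_quot :: "real \<Rightarrow> nat \<Rightarrow> real" where
  "cf_quot x 0 = x"
| "cf_quot x (Suc i) = 1 / frac (cf_quot x i)"

definition cf_coeff :: "real \<Rightarrow> nat \<Rightarrow> int" where
  "cf_coeff x i = \<lfloor>cf_quot x i\<rfloor>"

text \<open>The values at index 1 result from the three-term recurrence with \<open>p\<^sub>-\<^sub>1 = 1\<close> and
  \<open>q\<^sub>-\<^sub>1 = 0\<close>.\<close>

fun conv_num :: "real \<Rightarrow> nat \<Rightarrow> int" where
  "conv_num x 0 = cf_coeff x 0"
| "conv_num x (Suc 0) = cf_coeff x 1 * cf_coeff x 0 + 1"
| "conv_num x (Suc (Suc i)) = cf_coeff x (Suc (Suc i)) * conv_num x (Suc i) + conv_num x i"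

fun conv_denom :: "real \<Rightarrow> nat \<Rightarrow> int" where
  "conv_denom x 0 = 1"
| "conv_denom x (Suc 0) = cf_coeff x 1"
| "conv_denom x (Suc (Suc i)) = cf_coeff x (Suc (Suc i)) * conv_denom x (Suc i) + conv_denom x i"

definition convergent_at :: "real \<Rightarrow> nat \<Rightarrow> real" where
  "convergent_at x i = of_int (conv_num x i) / of_int (conv_denom x i)"

text \<open>The period length of the continued fraction of the square root of a non-square \<open>D\<close>, read
  off as the first index at which the partial denominator is twice the initial one.\<close>

definition sqrt_cf_period :: "int \<Rightarrow> nat \<Rightarrow> bool" where
  "sqrt_cf_period D l \<longleftrightarrow>
     l \<ge> 1 \<and> cf_coeff (sqrt (of_int D)) l = 2 * cf_coeff (sqrt (of_int D)) 0 \<and>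
     (\<forall>i. 1 \<le> i \<and> i < l \<longrightarrow>
        cf_coeff (sqrt (of_int D)) i \<noteq> 2 * cf_coeff (sqrt (of_int D)) 0)"

end

theory Submission
  imports Defs
begin

text \<open>
  Writing \<open>m = 2^(\<alpha> - 2) * n\<close>, the congruence says \<open>f = M * m\<close> with \<open>M\<close> odd, which forces \<open>m\<close> to be
  an integer, and \<open>D = M^2 * m^2 \<plusminus> 4 * m\<close>. With \<open>t = M^2 * m \<plusminus> 2\<close> one has \<open>t^2 - M^2 * D = 4\<close>, and the
  claimed convergents come from the square (\<open>m\<close> even) and the cube (\<open>m\<close> odd) of \<open>(t + M * sqrt D) / 2\<close>.
  The conditions on \<open>f\<close> become lower bounds on \<open>M\<close> under which the continued fraction of \<open>sqrt D\<close>
  can be written down explicitly, with a period of bounded length: one pattern for each sign and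
  parity of \<open>m\<close>, and a shorter one in the case of the sign \<open>-\<close> with \<open>M = 3\<close>. For \<open>m = 1\<close> the pattern
  of the odd case consists of two periods, which accounts for the index \<open>2 * r + 1\<close>.
\<close>

section \<open>Computing the continued fraction of \<open>sqrt D\<close> with integers only\<close>

text \<open>After the partial denominators \<open>cs\<close>, the complete quotient is \<open>(sqrt D + P) / Q\<close> and the last two
  denominators of convergents are \<open>q\<close> and \<open>q'\<close>. The numerators are recovered from \<open>p = P * q + Q * q'\<close>.
  Since \<open>w\<close> is the integer part of \<open>sqrt D\<close>, each floor reduces to integer inequalities.\<close>

definition sqrt_cf_state :: "int \<Rightarrow> int \<Rightarrow> int list \<Rightarrow> int \<Rightarrow> int \<Rightarrow> int \<Rightarrow> int \<Rightarrow> bool" where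
  "sqrt_cf_state D w cs P Q q q' \<longleftrightarrow>
     (let x = sqrt (of_int D); i = length cs in
      0 \<le> w \<and> w\<^sup>2 \<le> D \<and> D < (w + 1)\<^sup>2 \<and> 0 < Q \<and>
      cf_quot x i = (x + of_int P) / of_int Q \<and> map (cf_coeff x) [0..<i] = cs \<and>
      conv_denom x i = cf_coeff x i * q + q' \<and>
      conv_denom x (Suc i) = cf_coeff x (Suc i) * conv_denom x i + q \<and>
      (\<exists>p p'. conv_num x i = cf_coeff x i * p + p' \<and>
         conv_num x (Suc i) = cf_coeff x (Suc i) * conv_num x i + p \<and>
         p = P * q + Q * q' \<and> D * q = P * p + Q * p' \<and>
         (\<forall>j. i = Suc j \<longrightarrow> conv_num x j = p \<and> conv_denom x j = q)))"

text \<open>Before any partial denominator, \<open>0\<close> and \<open>1\<close> are the values of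
  \<open>q\<close> at the indices -1 and -2; the corresponding numerators are 1 and 0.\<close>

lemma sqrt_cf_state_start:
  assumes "0 \<le> w" "w\<^sup>2 \<le> D" "D < (w + 1)\<^sup>2"
  shows "sqrt_cf_state D w [] 0 1 0 1"
  using assms by (auto simp: sqrt_cf_state_def)

lemma floor_add_sqrt_divide:
  fixes D w P Q c :: int
  assumes "0 \<le> w" "w\<^sup>2 \<le> D" "D < (w + 1)\<^sup>2" "0 < Q" "c * Q \<le> w + P" "w + P < (c + 1) * Q"
  shows "\<lfloor>(sqrt (of_int D) + of_int P) / of_int Q\<rfloor> = c"
proof -
  have lo: "of_int w \<le> sqrt (of_int D :: real)"
    using assms(2) by (intro real_le_rsqrt) (metis of_int_le_iff of_int_power)
  have "of_int D < (of_int (w + 1) :: real)\<^sup>2"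
    using assms(3) by (metis of_int_less_iff of_int_power)
  then have hi: "sqrt (of_int D) < (of_int (w + 1) :: real)"
    using assms(1) by (intro real_less_lsqrt) auto
  have "of_int c * of_int Q \<le> (of_int w + of_int P :: real)"
    using assms(5) by (metis of_int_add of_int_le_iff of_int_mult)
  \<comment> \<open>Integrality turns the strict inequality into a gap of 1, which absorbs the
    fractional part of \<open>sqrt D\<close>.\<close>
  moreover have "of_int (w + P + 1) \<le> (of_int ((c + 1) * Q) :: real)"
    using assms(6) by (subst of_int_le_iff) linarith
  ultimately show ?thesis
    using lo hi assms(4) by (intro floor_unique) (simp_all add: field_simps)
qed

text \<open>This is the classical recursion for quadratic surds: the remainder is inverted by
  rationalizing with \<open>(x - P') * (x + P') = Q * Q'\<close>. The two identities linking
  \<open>p\<close>, \<open>p'\<close>, \<open>q\<close> and \<open>q'\<close> come from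
  \<open>x = (y * p + p') / (y * q + q')\<close> with the complete quotient
  \<open>y = (x + P) / Q\<close>, by comparing the coefficients of 1 and \<open>x\<close>.\<close>

lemma sqrt_cf_state_step:
  assumes st: "sqrt_cf_state D w cs P Q q q'"
    and c: "c * Q \<le> w + P" "w + P < (c + 1) * Q"
    and P': "P' = c * Q - P" and Q': "Q * Q' = D - P'\<^sup>2" "0 < Q'" and qn: "qn = c * q + q'"
    and cs': "cs' = cs @ [c]"
  shows "sqrt_cf_state D w cs' P' Q' qn q"
proof -
  define x where "x = sqrt (of_int D :: real)"
  define i where "i = length cs"
  from st obtain p p' where w: "0 \<le> w" "w\<^sup>2 \<le> D" "D < (w + 1)\<^sup>2" and Q: "0 < Q"
    and quot: "cf_quot x i = (x + of_int P) / of_int Q"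
    and map: "map (cf_coeff x) [0..<i] = cs"
    and denom: "conv_denom x i = cf_coeff x i * q + q'"
      "conv_denom x (Suc i) = cf_coeff x (Suc i) * conv_denom x i + q"
    and num: "conv_num x i = cf_coeff x i * p + p'"
      "conv_num x (Suc i) = cf_coeff x (Suc i) * conv_num x i + p"
    and p: "p = P * q + Q * q'" and Dq: "D * q = P * p + Q * p'"
    unfolding sqrt_cf_state_def Let_def x_def i_def by blast
  have fl: "\<lfloor>cf_quot x i\<rfloor> = c"
    unfolding quot unfolding x_def by (rule floor_add_sqrt_divide[OF w Q c])
  have D0: "0 \<le> D"
    using w(2) zero_le_power2[of w] by linarith
  have xx: "(x - of_int P') * (x + of_int P') = of_int Q * of_int Q'"
  proof -
    have "(x - of_int P') * (x + of_int P') = x\<^sup>2 - (of_int P')\<^sup>2"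
      by (simp add: algebra_simps power2_eq_square)
    also have "\<dots> = of_int (D - P'\<^sup>2)"
      using D0 by (simp add: x_def)
    finally show ?thesis
      unfolding Q'(1)[symmetric] by simp
  qed
  have fr: "frac (cf_quot x i) = (x - of_int P') / of_int Q"
    using Q by (simp add: frac_def fl) (simp add: quot P' field_simps)
  \<comment> \<open>Positivity of \<open>Q * Q'\<close> excludes \<open>x = P'\<close>, so the
    remainder can be inverted.\<close>
  have "x - of_int P' \<noteq> 0"
    using xx Q Q'(2) by auto
  then have quot': "cf_quot x (Suc i) = (x + of_int P') / of_int Q'"
    using xx Q Q'(2) by (simp add: fr frac_eq_eq mult.commute)
  have ci: "cf_coeff x i = c"
    using fl by (simp add: cf_coeff_def)
  \<comment> \<open>Both identities are proved after multiplication by \<open>Q\<close>, because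
    \<open>Q'\<close> is known only through the product \<open>Q * Q'\<close>.\<close>
  have "Q * (c * p + p') = Q * (P' * qn + Q' * q)"
  proof -
    have "Q * (P' * qn + Q' * q) = P' * (c * Q * q + Q * q') + (Q * Q') * q"
      by (simp add: qn algebra_simps)
    also have "\<dots> = P' * (c * Q * q + Q * q') + (D - P'\<^sup>2) * q"
      by (simp only: Q')
    also have "\<dots> = P' * p + D * q"
      by (simp add: P' p algebra_simps power2_eq_square)
    also have "\<dots> = Q * (c * p + p')"
      by (simp add: Dq P' algebra_simps)
    finally show ?thesis ..
  qed
  then have pn: "c * p + p' = P' * qn + Q' * q"
    using Q by simp
  have "Q * (D * qn) = Q * (P' * (c * p + p') + Q' * p)"
  proof -
    have "Q * (P' * (c * p + p') + Q' * p) = P' * (c * Q * p + Q * p') + (Q * Q') * p"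
      by (simp add: algebra_simps)
    also have "\<dots> = P' * (c * Q * p + Q * p') + (D - P'\<^sup>2) * p"
      by (simp only: Q')
    also have "\<dots> = P' * (P * p + Q * p') + D * p"
      by (simp add: P' algebra_simps power2_eq_square)
    also have "\<dots> = D * (P' * q + p)"
      by (simp add: Dq[symmetric] algebra_simps)
    also have "\<dots> = Q * (D * qn)"
      by (simp add: P' p qn algebra_simps)
    finally show ?thesis ..
  qed
  then have Dqn: "D * qn = P' * (c * p + p') + Q' * p"
    using Q by simp
  show ?thesis
    unfolding cs' sqrt_cf_state_def Let_def x_def[symmetric]
    using w Q'(2) quot' map denom num pn Dqn ci qn
    by (auto simp: i_def intro!: exI[of _ "c * p + p'"] exI[of _ p])
qed

text \<open>The numerator is recovered as \<open>P * q + Q * q'\<close>. The factor \<open>c\<close>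
  serves closed forms that are a multiple of the pair of numerator and denominator; it is 2 when
  they come from a cube.\<close>

lemma sqrt_cf_state_convergent:
  assumes st: "sqrt_cf_state D w cs P Q q q'" "length cs = Suc r"
    and c: "c \<noteq> 0" "c * (P * q + Q * q') = a" "c * q = b"
  shows "convergent_at (sqrt (of_int D)) r = of_int a / of_int b"
  using st c(1) by (auto simp: sqrt_cf_state_def Let_def convergent_at_def simp flip: c(2,3))

text \<open>At \<open>P = w\<close> and \<open>Q = 1\<close> the complete quotient is
  \<open>sqrt D + w\<close>, whose floor is \<open>2 * w\<close>. This is the end of the period as
  soon as \<open>2 * w\<close> has not occurred before.\<close>

lemma sqrt_cf_state_period:
  assumes st: "sqrt_cf_state D w (w # bs) w 1 q q'" and per: "sqrt_cf_period D l"
    and bs: "2 * w \<notin> set bs"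
  shows "l = Suc (length bs)"
proof -
  define x where "x = sqrt (of_int D :: real)"
  define cs where "cs = w # bs"
  from st have w: "0 \<le> w" "w\<^sup>2 \<le> D" "D < (w + 1)\<^sup>2"
    and quot: "cf_quot x (length cs) = (x + of_int w) / of_int 1"
    and map: "map (cf_coeff x) [0..<length cs] = cs"
    unfolding sqrt_cf_state_def x_def cs_def Let_def by blast+
  have nth: "cf_coeff x i = cs ! i" if "i < length cs" for i
    using that map by (metis add_0 length_map length_upt nth_map nth_upt)
  have 0: "cf_coeff x 0 = w"
    using nth[of 0] by (simp add: cs_def)
  have "\<lfloor>(sqrt (of_int D) + of_int w) / of_int 1\<rfloor> = 2 * w"
    by (rule floor_add_sqrt_divide[OF w]) auto
  then have L: "cf_coeff x (Suc (length bs)) = 2 * w"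
    using quot by (simp add: cf_coeff_def x_def cs_def)
  have less: "cf_coeff x i \<noteq> 2 * w" if i: "1 \<le> i" "i \<le> length bs" for i
  proof -
    obtain j where j: "i = Suc j" "j < length bs"
      using i by (cases i) auto
    then have "cf_coeff x i = bs ! j"
      using nth[of i] by (simp add: cs_def)
    then show ?thesis
      using bs j(2) by (metis nth_mem)
  qed
  have l: "l \<ge> 1" "cf_coeff x l = 2 * w" "\<And>i. 1 \<le> i \<Longrightarrow> i < l \<Longrightarrow> cf_coeff x i \<noteq> 2 * w"
    using per 0 by (auto simp: sqrt_cf_period_def x_def)
  have "\<not> l \<le> length bs"
    using l(1,2) less by blast
  moreover have "\<not> Suc (length bs) < l"
    using l(3)[of "Suc (length bs)"] L by auto
  ultimately show ?thesis by linarith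
qed

section \<open>Explicit expansions for even \<open>m = 2 * j\<close>\<close>

text \<open>The target is the square of \<open>(t + M * sqrt D) / 2\<close> with
  \<open>t = 2 * (M^2 * j + 1)\<close>. The period has length 8, and apart from its last term it is
  a palindrome around \<open>h - 1\<close>.\<close>

lemma convergent_plus_even:
  fixes j k D :: int
  assumes k: "k \<ge> 1" and j: "j \<ge> 1" and D: "D = ((2 * k + 1) * (2 * j))\<^sup>2 + 4 * (2 * j)"
    and per: "sqrt_cf_period D (r + 1)"
  shows "convergent_at (sqrt (of_int D)) r =
    of_int (2 * ((2 * k + 1)\<^sup>2 * j + 1)\<^sup>2 - 1) / of_int ((2 * k + 1) * ((2 * k + 1)\<^sup>2 * j + 1))"
proof -
  define M where "M = 2 * k + 1"
  define h where "h = M * j"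
  \<comment> \<open>The floor conditions contain the product \<open>k * j\<close>; expressing it by
    \<open>h\<close> and \<open>j\<close> makes them linear.\<close>
  have kj: "2 * (k * j) = h - j"
    by (simp add: h_def M_def algebra_simps)
  have "1 * j \<le> k * j" "k * 1 \<le> k * j"
    using k j by (intro mult_right_mono mult_left_mono; simp)+
  with kj j have h: "h \<ge> 3 * j" "h \<ge> 2 * k + 1"
    by linarith+
  have D': "D = 4 * h\<^sup>2 + 8 * j"
    by (simp add: D h_def M_def power2_eq_square)
  note [simp] = algebra_simps power2_eq_square
  have "sqrt_cf_state D (2 * h) [] 0 1 0 1"
    by (rule sqrt_cf_state_start) (use D' M_def kj h j k in simp_all)
  then have "sqrt_cf_state D (2 * h) [2 * h]
      (2 * h) (8 * j) 1 0"
    by (rule sqrt_cf_state_step[where c = "2 * h"]) (use D' M_def kj h j k in simp_all)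
  then have "sqrt_cf_state D (2 * h) [2 * h, k]
      (2 * h - 4 * j) (2 * h - 2 * j + 1) k 1"
    by (rule sqrt_cf_state_step[where c = "k"]) (use D' M_def kj h j k in simp_all)
  then have "sqrt_cf_state D (2 * h) [2 * h, k, 1]
      (2 * j + 1) (2 * h + 2 * j - 1) (k + 1) k"
    by (rule sqrt_cf_state_step[where c = "1"]) (use D' M_def kj h j k in simp_all)
  then have "sqrt_cf_state D (2 * h) [2 * h, k, 1, 1]
      (2 * h - 2) 4 M (k + 1)"
    by (rule sqrt_cf_state_step[where c = "1"]) (use D' M_def kj h j k in simp_all)
  then have "sqrt_cf_state D (2 * h) [2 * h, k, 1, 1, h - 1]
      (2 * h - 2) (2 * h + 2 * j - 1) ((h - 1) * M + k + 1) M"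
    by (rule sqrt_cf_state_step[where c = "h - 1"]) (use D' M_def kj h j k in simp_all)
  then have "sqrt_cf_state D (2 * h) [2 * h, k, 1, 1, h - 1, 1]
      (2 * j + 1) (2 * h - 2 * j + 1) (h * M + k + 1) ((h - 1) * M + k + 1)"
    by (rule sqrt_cf_state_step[where c = "1"]) (use D' M_def kj h j k in simp_all)
  then have "sqrt_cf_state D (2 * h) [2 * h, k, 1, 1, h - 1, 1, 1]
      (2 * h - 4 * j) (8 * j) (2 * h * M + 1) (h * M + k + 1)"
    by (rule sqrt_cf_state_step[where c = "1"]) (use D' M_def kj h j k in simp_all)
  then have st: "sqrt_cf_state D (2 * h) [2 * h, k, 1, 1, h - 1, 1, 1, k]
      (2 * h) 1 (M * (h * M + 1)) (2 * h * M + 1)"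
    by (rule sqrt_cf_state_step[where c = "k"]) (use D' M_def kj h j k in simp_all)
  have "r + 1 = Suc (length [k, 1, 1, h - 1, 1, 1, k])"
    by (rule sqrt_cf_state_period[OF st per]) (use h j k in auto)
  then have r: "r = 7"
    by simp
  show ?thesis
    by (rule sqrt_cf_state_convergent[OF st, where c = 1]) (simp_all add: r h_def M_def)
qed

text \<open>Now \<open>t = 2 * (M^2 * j - 1)\<close>, and the integer part drops to
  \<open>2 * h - 1\<close>, which changes the pattern. The bound on \<open>k\<close> keeps the
  partial denominator \<open>k - 1\<close> positive.\<close>

lemma convergent_minus_even:
  fixes j k D :: int
  assumes k: "k \<ge> 2" and j: "j \<ge> 1" and D: "D = ((2 * k + 1) * (2 * j))\<^sup>2 - 4 * (2 * j)"
    and per: "sqrt_cf_period D (r + 1)"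
  shows "convergent_at (sqrt (of_int D)) r =
    of_int (2 * ((2 * k + 1)\<^sup>2 * j - 1)\<^sup>2 - 1) / of_int ((2 * k + 1) * ((2 * k + 1)\<^sup>2 * j - 1))"
proof -
  define M where "M = 2 * k + 1"
  define h where "h = M * j"
  have kj: "2 * (k * j) = h - j"
    by (simp add: h_def M_def algebra_simps)
  have "2 * j \<le> k * j" "k * 1 \<le> k * j"
    using k j by (intro mult_right_mono mult_left_mono; simp)+
  with kj j have h: "h \<ge> 5 * j" "h \<ge> 2 * k + 1"
    by linarith+
  have D': "D = 4 * h\<^sup>2 - 8 * j"
    by (simp add: D h_def M_def power2_eq_square)
  note [simp] = algebra_simps power2_eq_square
  have "sqrt_cf_state D (2 * h - 1) [] 0 1 0 1"
    by (rule sqrt_cf_state_start) (use D' M_def kj h j k in simp_all)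
  then have "sqrt_cf_state D (2 * h - 1) [2 * h - 1]
      (2 * h - 1) (4 * h - 8 * j - 1) 1 0"
    by (rule sqrt_cf_state_step[where c = "2 * h - 1"]) (use D' M_def kj h j k in simp_all)
  then have "sqrt_cf_state D (2 * h - 1) [2 * h - 1, 1]
      (2 * h - 8 * j) (8 * j) 1 1"
    by (rule sqrt_cf_state_step[where c = "1"]) (use D' M_def kj h j k in simp_all)
  then have "sqrt_cf_state D (2 * h - 1) [2 * h - 1, 1, k - 1]
      (2 * h - 4 * j) (2 * h - 2 * j - 1) k 1"
    by (rule sqrt_cf_state_step[where c = "k - 1"]) (use D' M_def kj h j k in simp_all)
  then have "sqrt_cf_state D (2 * h - 1) [2 * h - 1, 1, k - 1, 2]
      (2 * h - 2) 4 M k"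
    by (rule sqrt_cf_state_step[where c = "2"]) (use D' M_def kj h j k in simp_all)
  then have "sqrt_cf_state D (2 * h - 1) [2 * h - 1, 1, k - 1, 2, h - 1]
      (2 * h - 2) (2 * h - 2 * j - 1) ((h - 1) * M + k) M"
    by (rule sqrt_cf_state_step[where c = "h - 1"]) (use D' M_def kj h j k in simp_all)
  then have "sqrt_cf_state D (2 * h - 1) [2 * h - 1, 1, k - 1, 2, h - 1, 2]
      (2 * h - 4 * j) (8 * j) (2 * h * M - 1) ((h - 1) * M + k)"
    by (rule sqrt_cf_state_step[where c = "2"]) (use D' M_def kj h j k in simp_all)
  then have "sqrt_cf_state D (2 * h - 1) [2 * h - 1, 1, k - 1, 2, h - 1, 2, k - 1]
      (2 * h - 8 * j) (4 * h - 8 * j - 1) (M * (h * M - 1) - 2 * h * M + 1) (2 * h * M - 1)"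
    by (rule sqrt_cf_state_step[where c = "k - 1"]) (use D' M_def kj h j k in simp_all)
  then have st: "sqrt_cf_state D (2 * h - 1) [2 * h - 1, 1, k - 1, 2, h - 1, 2, k - 1, 1]
      (2 * h - 1) 1 (M * (h * M - 1)) (M * (h * M - 1) - 2 * h * M + 1)"
    by (rule sqrt_cf_state_step[where c = "1"]) (use D' M_def kj h j k in simp_all)
  have "r + 1 = Suc (length [1, k - 1, 2, h - 1, 2, k - 1, 1])"
    by (rule sqrt_cf_state_period[OF st per]) (use h j k in auto)
  then have r: "r = 7"
    by simp
  show ?thesis
    by (rule sqrt_cf_state_convergent[OF st, where c = 1]) (simp_all add: r h_def M_def)
qed

section \<open>Explicit expansions for odd \<open>m\<close>\<close>

text \<open>Here \<open>t\<close> and \<open>M\<close> are odd, so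
  \<open>(t + M * sqrt D) / 2\<close> and its square have half-integral coefficients. By
  \<open>t^2 - M^2 * D = 4\<close> the cube is
  \<open>(t * (t^2 - 3) + M * (t^2 - 1) * sqrt D) / 2\<close>, which is integral; the fraction shows
  twice its coefficients.\<close>

lemma convergent_plus_odd:
  fixes k m D :: int
  assumes k: "k \<ge> 1" and m: "m \<ge> 1" "odd m" and D: "D = ((2 * k + 1) * m)\<^sup>2 + 4 * m"
    and t: "t = (2 * k + 1)\<^sup>2 * m + 2" and per: "sqrt_cf_period D (r + 1)"
  shows "convergent_at (sqrt (of_int D)) (if m = 1 then 2 * r + 1 else r) =
    of_int (t * (t\<^sup>2 - 3)) / of_int ((2 * k + 1) * (t\<^sup>2 - 1))"
proof -
  define M where "M = 2 * k + 1"
  define x where "x = M * m"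
  have "odd x"
    using m(2) by (simp add: x_def M_def)
  then obtain h where x: "x = 2 * h + 1"
    by (elim oddE)
  \<comment> \<open>Chosen as \<open>(t - 1) / 2\<close>, which is also the denominator reached
    halfway.\<close>
  define g where "g = h * M + k + 1"
  have t': "t = 2 * g + 1"
  proof -
    have "t = M * x + 2"
      by (simp add: t x_def M_def power2_eq_square)
    then show ?thesis
      by (simp add: x g_def M_def algebra_simps)
  qed
  have km: "2 * (k * m) = 2 * h + 1 - m"
    using x by (simp add: x_def M_def algebra_simps)
  have "1 * m \<le> k * m" "k * 1 \<le> k * m"
    using k m by (intro mult_right_mono mult_left_mono; simp)+
  with km m have h: "2 * h + 1 \<ge> 3 * m" "h \<ge> k"
    by linarith+
  have D': "D = x\<^sup>2 + 4 * m"
    by (simp add: D x_def M_def)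
  note [simp] = algebra_simps power2_eq_square
  have "sqrt_cf_state D x [] 0 1 0 1"
    by (rule sqrt_cf_state_start) (use D' M_def g_def x km h m(1) k in simp_all)
  then have "sqrt_cf_state D x [x]
      x (4 * m) 1 0"
    by (rule sqrt_cf_state_step[where c = "x"]) (use D' M_def g_def x km h m(1) k in simp_all)
  then have "sqrt_cf_state D x [x, k]
      (x - 2 * m) (x - m + 1) k 1"
    by (rule sqrt_cf_state_step[where c = "k"]) (use D' M_def g_def x km h m(1) k in simp_all)
  then have "sqrt_cf_state D x [x, k, 1]
      (m + 1) (x + m - 1) (k + 1) k"
    by (rule sqrt_cf_state_step[where c = "1"]) (use D' M_def g_def x km h m(1) k in simp_all)
  then have "sqrt_cf_state D x [x, k, 1, 1]
      (x - 2) 4 M (k + 1)"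
    by (rule sqrt_cf_state_step[where c = "1"]) (use D' M_def g_def x km h m(1) k in simp_all)
  \<comment> \<open>The complete quotient is now \<open>(sqrt D + x) / m\<close>. For
    \<open>m = 1\<close> this already closes a period of length 5, and the remaining terms run
    through a second one.\<close>
  then have mid: "sqrt_cf_state D x [x, k, 1, 1, h]
      x m g M"
    by (rule sqrt_cf_state_step[where c = "h"]) (use D' M_def g_def x km h m(1) k in simp_all)
  then have "sqrt_cf_state D x [x, k, 1, 1, h, 2 * M]
      x 4 (M * (2 * g + 1)) g"
    by (rule sqrt_cf_state_step[where c = "2 * M"]) (use D' M_def g_def x km h m(1) k in simp_all)
  then have "sqrt_cf_state D x [x, k, 1, 1, h, 2 * M, h]
      (x - 2) (x + m - 1) (h * M * (2 * g + 1) + g) (M * (2 * g + 1))"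
    by (rule sqrt_cf_state_step[where c = "h"]) (use D' M_def g_def x km h m(1) k in simp_all)
  then have "sqrt_cf_state D x [x, k, 1, 1, h, 2 * M, h, 1]
      (m + 1) (x - m + 1) (h * M * (2 * g + 1) + g + M * (2 * g + 1)) (h * M * (2 * g + 1) + g)"
    by (rule sqrt_cf_state_step[where c = "1"]) (use D' M_def g_def x km h m(1) k in simp_all)
  then have "sqrt_cf_state D x [x, k, 1, 1, h, 2 * M, h, 1, 1]
      (x - 2 * m) (4 * m) (2 * (h * M * (2 * g + 1) + g) + M * (2 * g + 1)) (h * M * (2 * g + 1) + g + M * (2 * g + 1))"
    by (rule sqrt_cf_state_step[where c = "1"]) (use D' M_def g_def x km h m(1) k in simp_all)
  then have st: "sqrt_cf_state D x [x, k, 1, 1, h, 2 * M, h, 1, 1, k]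
      x 1 (2 * M * g * (g + 1)) (2 * (h * M * (2 * g + 1) + g) + M * (2 * g + 1))"
    by (rule sqrt_cf_state_step[where c = "k"]) (use D' M_def g_def x km h m(1) k in simp_all)
  have r: "(if m = 1 then 2 * r + 1 else r) = 9"
  proof (cases "m = 1")
    case True
    then have "x = M"
      by (simp add: x_def)
    with True mid have mid': "sqrt_cf_state D x [x, k, 1, 1, h]
        x 1 g M"
      by simp
    have "r + 1 = Suc (length [k, 1, 1, h])"
      by (rule sqrt_cf_state_period[OF mid' per]) (use h m k x in auto)
    then show ?thesis
      using True by simp
  next
    case False
    with m have m3: "m \<ge> 3"
      by presburger
    \<comment> \<open>This separates the middle term \<open>2 * M\<close> from \<open>2 * x\<close>;
      for \<open>m = 1\<close> the two coincide.\<close>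
    have "M * 3 \<le> M * m"
      using m3 k by (intro mult_left_mono) (simp_all add: M_def)
    then have hM: "2 * h + 1 \<ge> 3 * M"
      using x by (simp add: x_def)
    have "r + 1 = Suc (length [k, 1, 1, h, 2 * M, h, 1, 1, k])"
      by (rule sqrt_cf_state_period[OF st per]) (use h m3 k x hM M_def in auto)
    then show ?thesis
      using False by simp
  qed
  show ?thesis
    unfolding r by (rule sqrt_cf_state_convergent[OF st, where c = 2]) (simp_all add: t' g_def x M_def)
qed

text \<open>The same cube, now with \<open>t = M^2 * m - 2\<close> and integer part
  \<open>x - 1\<close>. The pattern has length 12 and splits into two periods of length 6 when
  \<open>m = 1\<close>. The bound on \<open>k\<close> again keeps \<open>k - 1\<close>
  positive.\<close>

lemma convergent_minus_odd:
  fixes k m D :: int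
  assumes k: "k \<ge> 2" and m: "m \<ge> 1" "odd m" and D: "D = ((2 * k + 1) * m)\<^sup>2 - 4 * m"
    and t: "t = (2 * k + 1)\<^sup>2 * m - 2" and per: "sqrt_cf_period D (r + 1)"
  shows "convergent_at (sqrt (of_int D)) (if m = 1 then 2 * r + 1 else r) =
    of_int (t * (t\<^sup>2 - 3)) / of_int ((2 * k + 1) * (t\<^sup>2 - 1))"
proof -
  define M where "M = 2 * k + 1"
  define x where "x = M * m"
  have "odd x"
    using m(2) by (simp add: x_def M_def)
  then obtain h where x: "x = 2 * h + 1"
    by (elim oddE)
  \<comment> \<open>Here \<open>g\<close> is \<open>(t + 1) / 2\<close>.\<close>
  define g where "g = h * M + k"
  have t': "t = 2 * g - 1"
  proof -
    have "t = M * x - 2"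
      by (simp add: t x_def M_def power2_eq_square)
    then show ?thesis
      by (simp add: x g_def M_def algebra_simps)
  qed
  have km: "2 * (k * m) = 2 * h + 1 - m"
    using x by (simp add: x_def M_def algebra_simps)
  have "2 * m \<le> k * m" "k * 1 \<le> k * m"
    using k m by (intro mult_right_mono mult_left_mono; simp)+
  with km m have h: "2 * h + 1 \<ge> 5 * m" "h \<ge> k"
    by linarith+
  have D': "D = x\<^sup>2 - 4 * m"
    by (simp add: D x_def M_def)
  note [simp] = algebra_simps power2_eq_square
  have "sqrt_cf_state D (x - 1) [] 0 1 0 1"
    by (rule sqrt_cf_state_start) (use D' M_def g_def x km h m(1) k in simp_all)
  then have "sqrt_cf_state D (x - 1) [x - 1]
      (x - 1) (2 * x - 4 * m - 1) 1 0"
    by (rule sqrt_cf_state_step[where c = "x - 1"]) (use D' M_def g_def x km h m(1) k in simp_all)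
  then have "sqrt_cf_state D (x - 1) [x - 1, 1]
      (x - 4 * m) (4 * m) 1 1"
    by (rule sqrt_cf_state_step[where c = "1"]) (use D' M_def g_def x km h m(1) k in simp_all)
  then have "sqrt_cf_state D (x - 1) [x - 1, 1, k - 1]
      (x - 2 * m) (x - m - 1) k 1"
    by (rule sqrt_cf_state_step[where c = "k - 1"]) (use D' M_def g_def x km h m(1) k in simp_all)
  then have "sqrt_cf_state D (x - 1) [x - 1, 1, k - 1, 2]
      (x - 2) 4 M k"
    by (rule sqrt_cf_state_step[where c = "2"]) (use D' M_def g_def x km h m(1) k in simp_all)
  then have "sqrt_cf_state D (x - 1) [x - 1, 1, k - 1, 2, h - 1]
      (x - 4) (2 * x - m - 4) (g - M) M"
    by (rule sqrt_cf_state_step[where c = "h - 1"]) (use D' M_def g_def x km h m(1) k in simp_all)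
  \<comment> \<open>For \<open>m = 1\<close> this state has \<open>P = x - 1\<close> and
    \<open>Q = 1\<close>, so the first period ends here.\<close>
  then have mid: "sqrt_cf_state D (x - 1) [x - 1, 1, k - 1, 2, h - 1, 1]
      (x - m) m g (g - M)"
    by (rule sqrt_cf_state_step[where c = "1"]) (use D' M_def g_def x km h m(1) k in simp_all)
  then have "sqrt_cf_state D (x - 1) [x - 1, 1, k - 1, 2, h - 1, 1, 2 * M - 2]
      (x - m) (2 * x - m - 4) (M * (2 * g - 1) - g) g"
    by (rule sqrt_cf_state_step[where c = "2 * M - 2"]) (use D' M_def g_def x km h m(1) k in simp_all)
  then have "sqrt_cf_state D (x - 1) [x - 1, 1, k - 1, 2, h - 1, 1, 2 * M - 2, 1]
      (x - 4) 4 (M * (2 * g - 1)) (M * (2 * g - 1) - g)"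
    by (rule sqrt_cf_state_step[where c = "1"]) (use D' M_def g_def x km h m(1) k in simp_all)
  then have "sqrt_cf_state D (x - 1) [x - 1, 1, k - 1, 2, h - 1, 1, 2 * M - 2, 1, h - 1]
      (x - 2) (x - m - 1) (h * M * (2 * g - 1) - g) (M * (2 * g - 1))"
    by (rule sqrt_cf_state_step[where c = "h - 1"]) (use D' M_def g_def x km h m(1) k in simp_all)
  then have "sqrt_cf_state D (x - 1) [x - 1, 1, k - 1, 2, h - 1, 1, 2 * M - 2, 1, h - 1, 2]
      (x - 2 * m) (4 * m) (2 * (h * M * (2 * g - 1) - g) + M * (2 * g - 1)) (h * M * (2 * g - 1) - g)"
    by (rule sqrt_cf_state_step[where c = "2"]) (use D' M_def g_def x km h m(1) k in simp_all)
  then have "sqrt_cf_state D (x - 1) [x - 1, 1, k - 1, 2, h - 1, 1, 2 * M - 2, 1, h - 1, 2, k - 1]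
      (x - 4 * m) (2 * x - 4 * m - 1) (2 * M * g * (g - 1) - 2 * (h * M * (2 * g - 1) - g) - M * (2 * g - 1)) (2 * (h * M * (2 * g - 1) - g) + M * (2 * g - 1))"
    by (rule sqrt_cf_state_step[where c = "k - 1"]) (use D' M_def g_def x km h m(1) k in simp_all)
  then have st: "sqrt_cf_state D (x - 1) [x - 1, 1, k - 1, 2, h - 1, 1, 2 * M - 2, 1, h - 1, 2, k - 1, 1]
      (x - 1) 1 (2 * M * g * (g - 1)) (2 * M * g * (g - 1) - 2 * (h * M * (2 * g - 1) - g) - M * (2 * g - 1))"
    by (rule sqrt_cf_state_step[where c = "1"]) (use D' M_def g_def x km h m(1) k in simp_all)
  have r: "(if m = 1 then 2 * r + 1 else r) = 11"
  proof (cases "m = 1")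
    case True
    then have "x = M"
      by (simp add: x_def)
    with True mid have mid': "sqrt_cf_state D (x - 1) [x - 1, 1, k - 1, 2, h - 1, 1]
        (x - 1) 1 g (g - M)"
      by simp
    have "r + 1 = Suc (length [1, k - 1, 2, h - 1, 1])"
      by (rule sqrt_cf_state_period[OF mid' per]) (use h m k x in auto)
    then show ?thesis
      using True by simp
  next
    case False
    with m have m3: "m \<ge> 3"
      by presburger
    have "M * 3 \<le> M * m"
      using m3 k by (intro mult_left_mono) (simp_all add: M_def)
    then have hM: "2 * h + 1 \<ge> 3 * M"
      using x by (simp add: x_def)
    have "r + 1 = Suc (length [1, k - 1, 2, h - 1, 1, 2 * M - 2, 1, h - 1, 2, k - 1, 1])"
      by (rule sqrt_cf_state_period[OF st per]) (use h m3 k x hM M_def in auto)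
    then show ?thesis
      using False by simp
  qed
  show ?thesis
    unfolding r by (rule sqrt_cf_state_convergent[OF st, where c = 2]) (simp_all add: t' g_def x M_def)
qed

text \<open>For \<open>M = 3\<close> the term \<open>k - 1\<close> of the general pattern is 0. A
  zero partial denominator merges its neighbours into their sum, so each block
  \<open>1, 0, 2\<close> or \<open>2, 0, 1\<close> becomes a single 3 and the period shrinks from 12
  to 8.\<close>

lemma convergent_minus_odd_3:
  fixes m D :: int
  assumes m: "m \<ge> 3" "odd m" and D: "D = (3 * m)\<^sup>2 - 4 * m"
    and t: "t = 9 * m - 2" and per: "sqrt_cf_period D (r + 1)"
  shows "convergent_at (sqrt (of_int D)) r = of_int (t * (t\<^sup>2 - 3)) / of_int (3 * (t\<^sup>2 - 1))"
proof -
  obtain i where i: "m = 2 * i + 1"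
    using m(2) by (elim oddE)
  define h where "h = 3 * i + 1"
  define x where "x = 6 * i + 3"
  have t': "t = 6 * h + 1"
    by (simp add: t i h_def)
  have D': "D = x\<^sup>2 - 4 * m"
    by (simp add: D x_def i)
  note [simp] = algebra_simps power2_eq_square
  have "sqrt_cf_state D (x - 1) [] 0 1 0 1"
    by (rule sqrt_cf_state_start) (use D' x_def h_def i m(1) in simp_all)
  then have "sqrt_cf_state D (x - 1) [x - 1]
      (x - 1) (2 * m - 1) 1 0"
    by (rule sqrt_cf_state_step[where c = "x - 1"]) (use D' x_def h_def i m(1) in simp_all)
  then have "sqrt_cf_state D (x - 1) [x - 1, 3]
      (x - 2) 4 3 1"
    by (rule sqrt_cf_state_step[where c = "3"]) (use D' x_def h_def i m(1) in simp_all)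
  then have "sqrt_cf_state D (x - 1) [x - 1, 3, h - 1]
      (x - 4) (5 * m - 4) (3 * h - 2) 3"
    by (rule sqrt_cf_state_step[where c = "h - 1"]) (use D' x_def h_def i m(1) in simp_all)
  then have "sqrt_cf_state D (x - 1) [x - 1, 3, h - 1, 1]
      (2 * m) m (3 * h + 1) (3 * h - 2)"
    by (rule sqrt_cf_state_step[where c = "1"]) (use D' x_def h_def i m(1) in simp_all)
  then have "sqrt_cf_state D (x - 1) [x - 1, 3, h - 1, 1, 4]
      (2 * m) (5 * m - 4) (15 * h + 2) (3 * h + 1)"
    by (rule sqrt_cf_state_step[where c = "4"]) (use D' x_def h_def i m(1) in simp_all)
  then have "sqrt_cf_state D (x - 1) [x - 1, 3, h - 1, 1, 4, 1]
      (x - 4) 4 (18 * h + 3) (15 * h + 2)"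
    by (rule sqrt_cf_state_step[where c = "1"]) (use D' x_def h_def i m(1) in simp_all)
  then have "sqrt_cf_state D (x - 1) [x - 1, 3, h - 1, 1, 4, 1, h - 1]
      (x - 2) (2 * m - 1) (18 * h\<^sup>2 - 1) (18 * h + 3)"
    by (rule sqrt_cf_state_step[where c = "h - 1"]) (use D' x_def h_def i m(1) in simp_all)
  then have st: "sqrt_cf_state D (x - 1) [x - 1, 3, h - 1, 1, 4, 1, h - 1, 3]
      (x - 1) 1 (6 * h * (3 * h + 1)*3) (18 * h\<^sup>2 - 1)"
    by (rule sqrt_cf_state_step[where c = "3"]) (use D' x_def h_def i m(1) in simp_all)
  have "r + 1 = Suc (length [3, h - 1, 1, 4, 1, h - 1, 3])"
    by (rule sqrt_cf_state_period[OF st per]) (use m i in \<open>auto simp: h_def x_def\<close>)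
  then have r: "r = 7"
    by simp
  show ?thesis
    by (rule sqrt_cf_state_convergent[OF st, where c = 2]) (simp_all add: r t' x_def h_def)
qed

section \<open>Recovering \<open>M\<close> and \<open>m\<close> from the hypotheses and matching the
  closed forms\<close>

theorem theorem3:
  fixes n D s u :: int and \<alpha> r :: nat and f :: "int \<Rightarrow> int" and F N :: real
  assumes n_pos: "n > 0"
    and f_poly: "int_valued_polynomial f"
    and f_pos: "\<And>v. f v > 0"
    and f_cong: "\<And>v. [of_int (f v) = 2 powi (int \<alpha> - 2) * of_int n]
                       (rmod (2 powi (int \<alpha> - 1) * of_int n))"
    and sign: "s \<in> {1, -1}"
    and D_eq: "D = (f u)\<^sup>2 + s * 2 ^ \<alpha> * n"
    and D_pos: "D > 0"
    and D_nonsquare: "\<not> is_square D"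
    and period: "sqrt_cf_period D (r + 1)"
    and r_pos: "r > 0"
    and F_def: "F = of_int (f u)"
    and N_def: "N = of_int n"
    and cond_plus: "s = 1 \<Longrightarrow>
          (N \<le> 2 powi (2 - int \<alpha>) \<longrightarrow> F \<ge> 2 powi (int \<alpha> - 1) * N) \<and>
          (N > 2 powi (2 - int \<alpha>) \<longrightarrow> F \<ge> 3 * 2 powi (int \<alpha> - 2) * N - 1)"
    and cond_minus_even: "s = -1 \<Longrightarrow> even (f u) \<Longrightarrow>
          (\<alpha> \<ge> 2 \<or> (\<alpha> \<in> {0, 1} \<and> 3 * N \<ge> 2 powi (3 - int \<alpha>)) \<longrightarrow> F \<ge> 2 ^ \<alpha> * N) \<and>
          (\<alpha> \<in> {0, 1} \<and> 3 * N < 2 powi (3 - int \<alpha>) \<longrightarrow> F \<ge> 2 powi (int \<alpha> - 2) * N + 2)"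
    and cond_minus_odd: "s = -1 \<Longrightarrow> odd (f u) \<Longrightarrow>
          (N \<ge> 2 powi (2 - int \<alpha>) + 1 \<longrightarrow> F \<ge> 3 * 2 powi (int \<alpha> - 2) * N) \<and>
          (N \<le> 2 powi (2 - int \<alpha>) \<longrightarrow> F > 2 powi (int \<alpha> - 3) * N + 3)"
  shows "(even (f u) \<longrightarrow>
           convergent_at (sqrt (of_int D)) r =
             (F\<^sup>2 * (F\<^sup>2 + of_int s * 2 ^ \<alpha> * N) / (2 powi (2 * int \<alpha> - 3) * N\<^sup>2) + 1) /
             (F * (F\<^sup>2 + of_int s * 2 powi (int \<alpha> - 1) * N) / (2 powi (2 * int \<alpha> - 3) * N\<^sup>2))) \<and>
         (odd (f u) \<longrightarrow>
           convergent_at (sqrt (of_int D)) (if N = 2 powi (2 - int \<alpha>) then 2 * r + 1 else r) =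
             (F\<^sup>2 * (F\<^sup>2 + of_int s * 3 * 2 powi (int \<alpha> - 2) * N)\<^sup>2 /
                (2 powi (3 * int \<alpha> - 5) * N ^ 3) + of_int s) /
             (F * (F\<^sup>2 + of_int s * 2 powi (int \<alpha> - 2) * N) *
                (F\<^sup>2 + of_int s * 3 * 2 powi (int \<alpha> - 2) * N) /
                (2 powi (3 * int \<alpha> - 5) * N ^ 3)))"
proof -
  \<comment> \<open>For \<alpha> below 2 this is not an integer; only the product
    \<open>A * N\<close> will be identified with the integer \<open>m\<close>.\<close>
  define A :: real where "A = 2 powi (int \<alpha> - 2)"
  have A: "A > 0"
    by (simp add: A_def)
  have N: "N > 0"
    using n_pos by (simp add: N_def)
  have powi: "2 powi (int \<alpha> - 1) = 2 * A" "2 ^ \<alpha> = 4 * A" "2 powi (2 * int \<alpha> - 3) = 2 * A\<^sup>2"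
    "2 powi (3 * int \<alpha> - 5) = 2 * A ^ 3" "2 powi (2 - int \<alpha>) = 1 / A"
    "2 powi (3 - int \<alpha>) = 2 / A" "2 powi (int \<alpha> - 3) = A / 2"
  proof -
    have X: "A = 2 ^ \<alpha> / 4"
      by (simp add: A_def power_int_diff)
    have "2 powi (2 * int \<alpha>) = ((2 :: real) ^ \<alpha>)\<^sup>2"
      by (metis mult.commute of_nat_mult of_nat_numeral power_int_of_nat power_mult)
    moreover have "2 powi (3 * int \<alpha>) = ((2 :: real) ^ \<alpha>) ^ 3"
      by (metis mult.commute of_nat_mult of_nat_numeral power_int_of_nat power_mult)
    ultimately show "2 powi (int \<alpha> - 1) = 2 * A" "2 ^ \<alpha> = 4 * A" "2 powi (2 * int \<alpha> - 3) = 2 * A\<^sup>2"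
      "2 powi (3 * int \<alpha> - 5) = 2 * A ^ 3" "2 powi (2 - int \<alpha>) = 1 / A"
      "2 powi (3 - int \<alpha>) = 2 / A" "2 powi (int \<alpha> - 3) = A / 2"
      by (simp_all add: X power_int_diff power_divide)
  qed
  obtain k where k: "F = (2 * of_int k + 1) * (A * N)"
  proof -
    have "[2 powi (int \<alpha> - 2) * N = F] (rmod (2 powi (int \<alpha> - 1) * N))"
      using f_cong[of u] by (simp add: F_def N_def rcong_sym)
    then obtain k where "F = A * N + of_int k * (2 * A * N)"
      unfolding rcong_altdef powi(1) A_def[symmetric] by blast
    then show ?thesis
      using that[of k] by (simp add: algebra_simps)
  qed
  define M where "M = 2 * k + 1"
  have FM: "F = of_int M * (A * N)"
    by (simp add: k M_def)
  have "M > 0"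
  proof -
    have "F > 0"
      using f_pos[of u] by (simp add: F_def)
    then show ?thesis
      using mult_pos_pos[OF A N] by (auto simp: FM zero_less_mult_iff)
  qed
  \<comment> \<open>The odd number \<open>M\<close> divides \<open>4 * f u\<close>, hence
    \<open>f u\<close>; the quotient equals \<open>A * N\<close>, which is therefore an
    integer.\<close>
  obtain m where m: "f u = M * m"
  proof -
    have "of_int (4 * f u) = (of_int (M * (2 ^ \<alpha> * n)) :: real)"
      using FM powi(2) by (simp add: F_def N_def)
    then have "4 * f u = M * (2 ^ \<alpha> * n)"
      by (simp only: of_int_eq_iff)
    then have "M dvd 4 * f u"
      by simp
    moreover have "coprime M (2 ^ 2)"
      unfolding coprime_power_right_iff by (simp add: M_def coprime_right_2_iff_odd)
    ultimately show ?thesis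
      using that by (auto simp: coprime_dvd_mult_right_iff)
  qed
  have Am: "A * N = of_int m"
    using FM \<open>M > 0\<close> by (simp add: F_def m)
  have Fm: "F = of_int M * of_int m"
    by (simp add: FM Am)
  have m1: "m \<ge> 1"
    using Am A N by (metis mult_pos_pos of_int_0_less_iff zless_imp_add1_zle add_0)
  have D: "D = ((2 * k + 1) * m)\<^sup>2 + s * (4 * m)"
  proof -
    have "of_int (2 ^ \<alpha> * n) = (of_int (4 * m) :: real)"
      using powi(2) Am by (simp add: N_def)
    then have "2 ^ \<alpha> * n = 4 * m"
      by (simp only: of_int_eq_iff)
    then show ?thesis
      by (simp add: D_eq m M_def mult.assoc)
  qed
  have par: "even (f u) \<longleftrightarrow> even m"
    by (simp add: m M_def)
  have N_le: "N \<le> 1 / A \<longleftrightarrow> m = 1"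
  proof -
    have "N \<le> 1 / A \<longleftrightarrow> A * N \<le> 1"
      using A by (simp add: field_simps)
    then show ?thesis
      using m1 by (auto simp: Am)
  qed
  have N_eq: "N = 1 / A \<longleftrightarrow> m = 1"
  proof -
    have "N = 1 / A \<longleftrightarrow> A * N = 1"
      using A by (auto simp: field_simps)
    then show ?thesis
      by (auto simp: Am)
  qed
  \<comment> \<open>With \<open>k = 0\<close> one has \<open>F = m\<close>, against
    \<open>F \<ge> 2 * m\<close> for \<open>m = 1\<close> and against
    \<open>F \<ge> 3 * m - 1\<close> for larger \<open>m\<close>.\<close>
  have plus: "k \<ge> 1" if "s = 1"
  proof (rule ccontr)
    assume "\<not> k \<ge> 1"
    with \<open>M > 0\<close> have "k = 0"
      by (simp add: M_def)
    then have F: "F = of_int m"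
      by (simp add: Fm M_def)
    show False
    proof (cases "m = 1")
      case True
      then show ?thesis
        using cond_plus[OF that] N_le F Am by (simp add: powi)
    next
      case False
      then have "\<not> N \<le> 1 / A"
        using N_le by simp
      then show ?thesis
        using cond_plus[OF that] N_le F Am m1 False by (simp add: powi flip: A_def)
    qed
  qed
  have M_ge: "M \<ge> c" if "F \<ge> of_int c * of_int m" for c
  proof -
    have "of_int (c * m) \<le> (of_int (M * m) :: real)"
      using that by (simp add: Fm)
    then have "c * m \<le> M * m"
      by (simp only: of_int_le_iff)
    then show ?thesis
      using m1 by simp
  qed
  have minus_even: "k \<ge> 2" if s: "s = -1" and "even m"
  proof -
    have "1 \<le> A * N"
      using m1 by (simp add: Am)
    \<comment> \<open>This gives the bound \<open>F \<ge> 4 * m\<close> for \<alpha> equal to 0 or 1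
      as well; as \<open>M\<close> is odd, it is at least 5.\<close>
    then have "3 * N \<ge> 2 / A"
      using A N by (simp add: field_simps)
    moreover have "\<alpha> \<ge> 2 \<or> \<alpha> \<in> {0, 1}"
      by auto
    ultimately have "F \<ge> 2 ^ \<alpha> * N"
      using cond_minus_even[OF s] \<open>even m\<close> by (simp add: par powi(6))
    then have "M \<ge> 4"
      using M_ge[of 4] by (simp add: powi(2) mult.assoc Am)
    then show ?thesis
      by (simp add: M_def)
  qed
  have minus_odd: "k \<ge> (if m = 1 then 2 else 1)" if s: "s = -1" and "odd m"
  proof (cases "m = 1")
    case True
    then have "F > A * N / 2 + 3"
      using cond_minus_odd[OF s] \<open>odd m\<close> N_le by (simp add: par powi)
    then have "of_int M > (3 :: real)"
      using True by (simp add: Am Fm)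
    then show ?thesis
      using True by (simp add: M_def)
  next
    case False
    \<comment> \<open>For larger \<alpha> the number \<open>m\<close> would be even. Hence
      \<open>1 / A\<close> is an integer, and \<open>N > 1 / A\<close> improves to
      \<open>N \<ge> 1 / A + 1\<close>, the form in which the condition is stated.\<close>
    have "\<alpha> \<le> 2"
    proof (rule ccontr)
      assume "\<not> \<alpha> \<le> 2"
      then obtain b where b: "\<alpha> = Suc (Suc (Suc b))"
        by (metis add_Suc_right less_imp_Suc_add not_le numeral_2_eq_2 add_Suc add_0)
      have "of_int m = (of_int (2 * (2 ^ b * n)) :: real)"
        using powi(2) by (simp add: N_def b flip: Am)
      then have "m = 2 * (2 ^ b * n)"
        by (simp only: of_int_eq_iff)
      with \<open>odd m\<close> show False
        by simp
    qed
    then have e: "2 - int \<alpha> = int (2 - \<alpha>)"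
      by simp
    have A_inv: "1 / A = of_int (2 ^ (2 - \<alpha>))"
      unfolding powi(5)[symmetric] e by simp
    have "\<not> N \<le> 1 / A"
      using False N_le by simp
    then have "n > 2 ^ (2 - \<alpha>)"
      unfolding A_inv N_def of_int_le_iff by simp
    then have "N \<ge> of_int (2 ^ (2 - \<alpha>) + 1)"
      unfolding N_def of_int_le_iff by simp
    then have "N \<ge> 1 / A + 1"
      using A_inv by simp
    then have "M \<ge> 3"
      using cond_minus_odd[OF s] \<open>odd m\<close> M_ge[of 3] Am
      by (simp add: par powi mult.assoc flip: A_def)
    then show ?thesis
      using False by (simp add: M_def)
  qed
  have AN: "2 * A\<^sup>2 * N\<^sup>2 = 2 * (of_int m)\<^sup>2" "2 * A ^ 3 * N ^ 3 = 2 * of_int m ^ 3"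
    by (simp_all add: power_mult_distrib flip: Am)
  have m0: "of_int m \<noteq> (0 :: real)"
    using m1 by simp
  have even: "convergent_at (sqrt (of_int D)) r =
      (F\<^sup>2 * (F\<^sup>2 + of_int s * 4 * A * N) / (2 * A\<^sup>2 * N\<^sup>2) + 1) /
      (F * (F\<^sup>2 + of_int s * (2 * A) * N) / (2 * A\<^sup>2 * N\<^sup>2))" if "even m"
  proof -
    obtain j where j: "m = 2 * j"
      using \<open>even m\<close> by (elim evenE)
    have "convergent_at (sqrt (of_int D)) r =
        of_int (2 * (M\<^sup>2 * j + s)\<^sup>2 - 1) / of_int (M * (M\<^sup>2 * j + s))"
      using sign
    proof (elim insertE emptyE)
      assume s: "s = 1"
      show ?thesis
        unfolding s M_def
        by (rule convergent_plus_even) (use plus s m1 j D period in auto)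
    next
      assume s: "s = -1"
      have "convergent_at (sqrt (of_int D)) r =
          of_int (2 * (M\<^sup>2 * j - 1)\<^sup>2 - 1) / of_int (M * (M\<^sup>2 * j - 1))"
        unfolding M_def
        by (rule convergent_minus_even) (use minus_even \<open>even m\<close> s m1 j D period in auto)
      then show ?thesis
        by (simp add: s)
    qed
    \<comment> \<open>Completing the square:
      \<open>F^2 * (F^2 + 4 * s * m) = (F^2 + 2 * s * m)^2 - 4 * m^2\<close>, where
      \<open>F^2 + 2 * s * m = 2 * m * (M^2 * j + s)\<close>.\<close>
    also have "of_int (2 * (M\<^sup>2 * j + s)\<^sup>2 - 1) =
        F\<^sup>2 * (F\<^sup>2 + of_int s * 4 * A * N) / (2 * A\<^sup>2 * N\<^sup>2) + 1"
      using sign m0 unfolding AN mult.assoc[of _ A] Am Fm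
      by (auto simp: j field_simps power2_eq_square)
    also have "of_int (M * (M\<^sup>2 * j + s)) =
        F * (F\<^sup>2 + of_int s * (2 * A) * N) / (2 * A\<^sup>2 * N\<^sup>2)"
      using m0 unfolding AN mult.assoc[of _ A] mult.assoc[of _ "2 * A"] Am Fm
      by (simp add: j field_simps power2_eq_square)
    finally show ?thesis .
  qed
  have odd: "convergent_at (sqrt (of_int D)) (if m = 1 then 2 * r + 1 else r) =
      (F\<^sup>2 * (F\<^sup>2 + of_int s * 3 * A * N)\<^sup>2 / (2 * A ^ 3 * N ^ 3) + of_int s) /
      (F * (F\<^sup>2 + of_int s * A * N) * (F\<^sup>2 + of_int s * 3 * A * N) / (2 * A ^ 3 * N ^ 3))"
    (is "_ = ?p / ?q") if "odd m"
  proof -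
    define t where "t = M\<^sup>2 * m + s * 2"
    have "convergent_at (sqrt (of_int D)) (if m = 1 then 2 * r + 1 else r) =
        of_int (t * (t\<^sup>2 - 3)) / of_int (M * (t\<^sup>2 - 1))"
      using sign
    proof (elim insertE emptyE)
      assume s: "s = 1"
      show ?thesis
        unfolding M_def
        by (rule convergent_plus_odd) (use plus s m1 \<open>odd m\<close> D t_def M_def period in auto)
    next
      assume s: "s = -1"
      show ?thesis
      proof (cases "k \<ge> 2")
        case True
        show ?thesis
          unfolding M_def
          by (rule convergent_minus_odd) (use True s m1 \<open>odd m\<close> D t_def M_def period in auto)
      next
        case False
        then have k: "k = 1" and "m \<noteq> 1"
          using minus_odd[OF s \<open>odd m\<close>] by (auto split: if_splits)
        moreover have "m \<ge> 3"
          using m1 \<open>odd m\<close> \<open>m \<noteq> 1\<close> by presburger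
        then have "convergent_at (sqrt (of_int D)) r = of_int (t * (t\<^sup>2 - 3)) / of_int (3 * (t\<^sup>2 - 1))"
          by (intro convergent_minus_odd_3) (use k s \<open>odd m\<close> D t_def M_def period in auto)
        ultimately show ?thesis
          by (simp add: M_def)
      qed
    qed
    \<comment> \<open>Since \<open>F = M * m\<close>, the factors \<open>F^2\<close>,
      \<open>F^2 + s * m\<close> and \<open>F^2 + 3 * s * m\<close> are \<open>m\<close> times
      \<open>t - 2 * s\<close>, \<open>t - s\<close> and \<open>t + s\<close>.\<close>
    also have "of_int (t * (t\<^sup>2 - 3)) = 2 * ?p"
      using sign m0 unfolding AN mult.assoc[of _ A] Am Fm
      by (auto simp: t_def field_simps power2_eq_square power3_eq_cube)
    also have "of_int (M * (t\<^sup>2 - 1)) = 2 * ?q"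
      using sign m0 unfolding AN mult.assoc[of _ A] Am Fm
      by (auto simp: t_def field_simps power2_eq_square power3_eq_cube)
    finally show ?thesis
      by (simp only: mult_divide_mult_cancel_left_if) simp
  qed
  show ?thesis
    using even odd by (simp only: par powi N_eq A_def[symmetric]) (simp add: mult.assoc)
qed

end
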